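(* For any positive integers $r$, $k$, $\Theta$, and $\Gamma$ such that $k \geq 2$ and $r \geq k + \Gamma$, there exists a connected (finite, simple) graph $G$ for which $$\omega(G) = \chi(G) = k, \qquad \chi\left(G, rK_2\right) = \Theta, \qquad \text{and} \qquad |E(G)| - \mathrm{ex}\left(G, rK_2\right) = \Theta + \Gamma .$$
   Context: All graphs are finite and simple. For a graph $G$, $\omega(G)$ denotes its clique number, $\chi(G)$ its chromatic number, and $E(G)$ its edge set. An $r$-matching, denoted $rK_2$, is a matching of size $r$ (a set of $r$ pairwise vertex-disjoint edges). The matching Kneser graph $\left(G, rK_2\right)$ is the graph whose vertices are all $r$-matchings of $G$ (each viewed as a set of $r$ edges of $G$), two $r$-matchings being adjacent whenever they are disjoint as sets of edges (i.e. they have no edge of $G$ in common). $\chi\left(G, rK_2\right)$ denotes the chromatic number of the graph $\left(G, rK_2\right)$; it is $0$ if $G$ has no $r$-matching. A graph is $\left(rK_2\right)$-free if it contains no $rK_2$ as a (not necessarily induced) subgraph. The generalized Turán number $\mathrm{ex}\left(G, rK_2\right)$ is the maximum of $|E(H)|$ over all $\left(rK_2\right)$-free spanning subgraphs $H$ of $G$ (where a spanning subgraph of $G$ has the same vertex set as $G$ and an edge set contained in $E(G)$). *)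

theory Defs
  imports Main "HOL-Library.Ramsey" "HOL-Library.Disjoint_Sets"
begin

record 'a ugraph =
  verts :: "'a set"
  edges :: "'a set set"

definition simple_graph :: "'a ugraph \<Rightarrow> bool" where
  "simple_graph G \<longleftrightarrow> finite (verts G) \<and> edges G \<subseteq> [verts G]\<^bsup>2\<^esup>"

definition connected_graph :: "'a ugraph \<Rightarrow> bool" where
  "connected_graph G \<longleftrightarrow> verts G \<noteq> {} \<and>
     (\<forall>u\<in>verts G. \<forall>v\<in>verts G. (u, v) \<in> {(x, y). {x, y} \<in> edges G}\<^sup>*)"

definition clique_number :: "'a ugraph \<Rightarrow> nat" where
  "clique_number G = Max {card K | K. K \<subseteq> verts G \<and> clique K (edges G)}"

definition proper_colouring :: "'a ugraph \<Rightarrow> nat \<Rightarrow> ('a \<Rightarrow> nat) \<Rightarrow> bool" where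
  "proper_colouring G n c \<longleftrightarrow> c ` verts G \<subseteq> {..<n} \<and>
     (\<forall>u\<in>verts G. \<forall>v\<in>verts G. {u, v} \<in> edges G \<longrightarrow> c u \<noteq> c v)"

definition chromatic_number :: "'a ugraph \<Rightarrow> nat" where
  "chromatic_number G = (LEAST n. \<exists>c. proper_colouring G n c)"

definition matchings :: "'a ugraph \<Rightarrow> nat \<Rightarrow> 'a set set set" where
  "matchings G r = {M \<in> [edges G]\<^bsup>r\<^esup>. disjoint M}"

text \<open>The condition \<open>M \<noteq> N\<close> only matters for \<open>r = 0\<close>, where it excludes a loop at
  the empty matching.\<close>

definition matching_kneser :: "'a ugraph \<Rightarrow> nat \<Rightarrow> 'a set set ugraph" where
  "matching_kneser G r =
     \<lparr>verts = matchings G r,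
      edges = {{M, N} | M N. M \<in> matchings G r \<and> N \<in> matchings G r \<and> M \<noteq> N \<and> disjnt M N}\<rparr>"

definition matching_free :: "'a ugraph \<Rightarrow> nat \<Rightarrow> bool" where
  "matching_free H r \<longleftrightarrow> matchings H r = {}"

definition spanning_subgraph :: "'a ugraph \<Rightarrow> 'a ugraph \<Rightarrow> bool" where
  "spanning_subgraph H G \<longleftrightarrow> verts H = verts G \<and> edges H \<subseteq> edges G"

text \<open>For \<open>r = 0\<close> no graph is free of \<open>r\<close>-matchings and the value is unspecified.\<close>

definition ex_matching :: "'a ugraph \<Rightarrow> nat \<Rightarrow> nat" where
  "ex_matching G r = Max {card (edges H) | H. spanning_subgraph H G \<and> matching_free H r}"

lemma finite_edges: "simple_graph G \<Longrightarrow> finite (edges G)"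
  unfolding simple_graph_def by (meson finite_imp_finite_nsets finite_subset)

lemma finite_matchings: "simple_graph G \<Longrightarrow> finite (matchings G r)"
  by (simp add: matchings_def finite_edges finite_imp_finite_nsets)

lemma simple_graph_matching_kneser: "simple_graph G \<Longrightarrow> simple_graph (matching_kneser G r)"
  unfolding simple_graph_def[of "matching_kneser G r"]
  by (auto simp: matching_kneser_def finite_matchings)

lemma chromatic_number_colouring:
  assumes "simple_graph G"
  shows "\<exists>c. proper_colouring G (chromatic_number G) c"
proof -
  obtain f :: "'a \<Rightarrow> nat" and n where f: "f ` verts G = {i. i < n}" "inj_on f (verts G)"
    using finite_imp_inj_to_nat_seg[of "verts G"] assms unfolding simple_graph_def by metis
  have "proper_colouring G n f"
    unfolding proper_colouring_def
  proof (intro conjI ballI impI)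
    show "f ` verts G \<subseteq> {..<n}"
      using f(1) by auto
    fix u v assume uv: "u \<in> verts G" "v \<in> verts G" "{u, v} \<in> edges G"
    then have "{u, v} \<in> [verts G]\<^bsup>2\<^esup>"
      using assms unfolding simple_graph_def by (meson subsetD)
    then have "u \<noteq> v"
      by simp
    then show "f u \<noteq> f v"
      using uv f(2) by (meson inj_onD)
  qed
  then have "\<exists>n c. proper_colouring G n c"
    by (intro exI)
  then show ?thesis
    unfolding chromatic_number_def by (rule LeastI_ex)
qed

lemma chromatic_number_le: "proper_colouring G n c \<Longrightarrow> chromatic_number G \<le> n"
  unfolding chromatic_number_def by (rule Least_le) (rule exI)

lemma chromatic_number_no_verts: "verts G = {} \<Longrightarrow> chromatic_number G = 0"
  using chromatic_number_le[of G 0] by (simp add: proper_colouring_def)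

lemma clique_number_set:
  assumes "simple_graph G"
  shows "finite {card K | K. K \<subseteq> verts G \<and> clique K (edges G)}"
    and "{card K | K. K \<subseteq> verts G \<and> clique K (edges G)} \<noteq> {}"
proof -
  have "{card K | K. K \<subseteq> verts G \<and> clique K (edges G)} \<subseteq> card ` Pow (verts G)"
    by auto
  then show "finite {card K | K. K \<subseteq> verts G \<and> clique K (edges G)}"
    using assms unfolding simple_graph_def by (meson finite_Pow_iff finite_imageI finite_subset)
  show "{card K | K. K \<subseteq> verts G \<and> clique K (edges G)} \<noteq> {}"
    using null_clique[of "edges G"] by blast
qed

lemma ex_matching_set:
  assumes "simple_graph G"
  shows "finite {card (edges H) | H. spanning_subgraph H G \<and> matching_free H r}"
    and "r \<ge> 1 \<Longrightarrow> {card (edges H) | H. spanning_subgraph H G \<and> matching_free H r} \<noteq> {}"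
proof -
  have "{card (edges H) | H. spanning_subgraph H G \<and> matching_free H r} \<subseteq> card ` Pow (edges G)"
    by (auto simp: spanning_subgraph_def)
  then show "finite {card (edges H) | H. spanning_subgraph H G \<and> matching_free H r}"
    using finite_edges[OF assms] by (meson finite_Pow_iff finite_imageI finite_subset)
  show "{card (edges H) | H. spanning_subgraph H G \<and> matching_free H r} \<noteq> {}" if "r \<ge> 1"
  proof -
    let ?H = "\<lparr>verts = verts G, edges = {}\<rparr>"
    have "spanning_subgraph ?H G" "matching_free ?H r"
      using that by (auto simp: spanning_subgraph_def matching_free_def matchings_def nsets_def)
    then show ?thesis by blast
  qed
qed

end

theory Submission
  imports Defs
begin

text \<open>
  Put \<open>t = \<Gamma> + 1\<close>, \<open>e = \<Theta> + 2 \<Gamma>\<close> and \<open>N = r - t\<close>, so that \<open>N \<ge> k - 1\<close>. The graph consists of \<open>N\<close>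
  hubs, a large independent set all of whose vertices are joined to every hub, and \<open>e\<close> disjoint
  edges, the links, each leading from the independent set to a new vertex of degree one. Making
  \<open>k - 1\<close> of the hubs pairwise adjacent gives clique number and chromatic number \<open>k\<close>; the hubs make
  the graph connected.

  Every edge other than a link meets one of the \<open>N\<close> hubs, so an \<open>r\<close>-matching contains at least
  \<open>r - N = t\<close> links (\<open>card_linked_ge\<close>). Conversely any \<open>t\<close> links extend to an \<open>r\<close>-matching by a
  matching of all hubs into the independent set, and that set is so large that there are \<open>2 ^ e\<close>
  pairwise disjoint choices of this extension (\<open>spokes_links_matching\<close>). Thus the \<open>r\<close>-matchings
  behave like the \<open>t\<close>-subsets of an \<open>e\<close>-set:

  \<^item> The least number of edges that meets every \<open>r\<close>-matching is \<open>e - t + 1 = \<Theta> + \<Gamma>\<close>. Deleting that many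
    links leaves only \<open>t - 1\<close> of them; deleting fewer edges leaves \<open>t\<close> links and one of the \<open>2 ^ e\<close>
    extensions intact.

  \<^item> The chromatic number of the matching Kneser graph is that of the Kneser graph of the
    \<open>t\<close>-subsets of an \<open>e\<close>-set, namely \<open>e - 2 t + 2 = \<Theta>\<close>. The lower bound is Lovasz's theorem
    (\<open>kneser_colouring_bound\<close>): giving different \<open>t\<close>-subsets disjoint extensions maps the Kneser
    graph homomorphically into the matching Kneser graph.

  Lovasz's theorem is derived, following Matousek, from a combinatorial form of Tucker's lemma on
  the barycentric subdivision of the boundary of the cross-polytope, and this in turn from Fan's
  parity theorem (\<open>odd_card_alternating_chains\<close>), which is proved by counting facets of a hemisphere
  in two ways.
\<close>

section \<open>Alternating sets of integers\<close>

text \<open>Points moved by an involution come in pairs.\<close>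

lemma odd_card_involution:
  assumes "finite P" "\<And>x. x \<in> P \<Longrightarrow> f x \<in> P" "\<And>x. x \<in> P \<Longrightarrow> f (f x) = x"
  shows "odd (card P) \<longleftrightarrow> odd (card {x \<in> P. f x = x})"
  using assms
proof (induction P rule: finite_psubset_induct)
  case (psubset P)
  show ?case
  proof (cases "\<exists>x\<in>P. f x \<noteq> x")
    case False
    then have "{x \<in> P. f x = x} = P" by auto
    then show ?thesis by simp
  next
    case True
    then obtain x where x: "x \<in> P" "f x \<noteq> x" by blast
    let ?Q = "P - {x, f x}"
    have stable: "f y \<in> ?Q" if "y \<in> ?Q" for y
      using that psubset.prems x by (metis Diff_iff insert_iff empty_iff)
    have "odd (card ?Q) \<longleftrightarrow> odd (card {y \<in> ?Q. f y = y})"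
    proof (rule psubset.IH)
      show "?Q \<subset> P" using x by blast
    qed (use stable psubset.prems in auto)
    moreover have "{y \<in> ?Q. f y = y} = {y \<in> P. f y = y}"
      using x psubset.prems by auto
    moreover have "card P = card ?Q + 2"
      using x psubset card_Diff_subset[of "{x, f x}" P] card_mono[of P "{x, f x}"] by simp
    ultimately show ?thesis by simp
  qed
qed

text \<open>Ordered by absolute value, the elements of an alternating set have alternating signs, the first
  of them being \<open>s\<close>.\<close>

inductive alternating :: "int \<Rightarrow> int set \<Rightarrow> bool" where
  empty: "alternating s {}"
| insert: "alternating s (insert x S)"
    if "alternating (- s) S" "sgn x = s" "\<forall>y\<in>S. \<bar>x\<bar> < \<bar>y\<bar>"

lemma alternating_insert_iff:
  assumes "\<forall>y\<in>S. \<bar>x\<bar> < \<bar>y\<bar>"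
  shows "alternating s (insert x S) \<longleftrightarrow> sgn x = s \<and> alternating (- s) S"
proof
  assume "alternating s (insert x S)"
  then show "sgn x = s \<and> alternating (- s) S"
  proof cases
    case (insert S' x')
    have "x' = x"
      using insert(1,4) assms by (metis insert_iff order_less_asym)
    moreover have "x \<notin> S" "x' \<notin> S'" using assms insert(4) by auto
    ultimately have "S' = S" using insert(1) by (metis insert_ident)
    with \<open>x' = x\<close> insert show ?thesis by simp
  qed simp
next
  assume "sgn x = s \<and> alternating (- s) S"
  then show "alternating s (insert x S)" using assms by (auto intro: alternating.insert)
qed

lemma alternating_uminus: "alternating s S \<Longrightarrow> alternating (- s) (uminus ` S)"
proof (induction rule: alternating.induct)
  case (insert s S x)
  then have "alternating (- s) (insert (- x) (uminus ` S))"
    by (intro alternating.insert) (auto simp: sgn_minus)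
  then show ?case by simp
qed (simp add: alternating.empty)

lemma alternating_sign_unique:
  assumes "alternating s S" "alternating (- s) S" "S \<noteq> {}" "\<bar>s\<bar> = 1"
  shows False
  using assms(1)
proof cases
  case (insert T x)
  then have "alternating (- s) (insert x T)" using assms(2) by simp
  then have "sgn x = - s" using alternating_insert_iff insert(4) by blast
  then show False using insert assms(4) by simp
qed (use assms in auto)

text \<open>The elements are added in order of decreasing absolute value. A set that is not alternating but
  becomes so when one element is removed has two neighbouring elements of equal sign, and removing
  either of them works; from an alternating set only the removal of one of the two ends leaves a set
  that starts with the prescribed sign.\<close>

lemma odd_alternating_deletions:
  assumes "finite L" "\<And>x y. x \<in> L \<Longrightarrow> y \<in> L \<Longrightarrow> x \<noteq> - y" "\<bar>s\<bar> = 1"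
  shows "odd (card {x \<in> L. alternating s (L - {x})}) \<longleftrightarrow>
         L \<noteq> {} \<and> (alternating s L \<or> alternating (- s) L)"
  using assms
proof (induction L arbitrary: s rule: finite_ranking_induct[where f = "\<lambda>x. - \<bar>x\<bar>"])
  case empty
  then show ?case by simp
next
  case (insert x S)
  show ?case
  proof (cases "x \<in> S")
    case True
    then have "insert x S = S" by blast
    then show ?thesis using insert.IH[of s] insert.prems by simp
  next
    case False
    have less: "\<bar>x\<bar> < \<bar>y\<bar>" if "y \<in> S" for y
    proof -
      have "\<bar>x\<bar> \<le> \<bar>y\<bar>" using insert.hyps(2)[OF that] by simp
      moreover have "x \<noteq> y" using that False by blast
      moreover have "x \<noteq> - y" using insert.prems(1) that by blast
      ultimately show ?thesis by linarith
    qed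
    have "sgn x = s \<or> sgn x = - s"
      using insert.prems(1)[of x x] insert.prems(2) by (auto simp: sgn_if)
    let ?D = "{y \<in> S. alternating (- s) (S - {y})}"
    have del: "alternating s (insert x S - {y}) \<longleftrightarrow> sgn x = s \<and> alternating (- s) (S - {y})"
      if "y \<in> S" for y
    proof -
      have "insert x S - {y} = insert x (S - {y})" using that False by blast
      then show ?thesis using alternating_insert_iff[of "S - {y}" x s] less by simp
    qed
    have IH: "odd (card ?D) \<longleftrightarrow> S \<noteq> {} \<and> (alternating (- s) S \<or> alternating s S)"
      using insert.IH[of "- s"] insert.prems by simp
    have ins: "alternating s' (insert x S) \<longleftrightarrow> sgn x = s' \<and> alternating (- s') S" for s'
      using alternating_insert_iff less by blast
    have delx: "insert x S - {x} = S" using False by simp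
    have s: "s \<noteq> - s" using insert.prems(2) by auto
    have eq: "{y \<in> insert x S. alternating s (insert x S - {y})} =
      (if alternating s S then {x} else {}) \<union> (if sgn x = s then ?D else {})"
      using del delx by auto
    have "x \<notin> ?D" "finite ?D" using False insert.hyps by auto
    then have cardeq: "card {y \<in> insert x S. alternating s (insert x S - {y})} =
      (if alternating s S then 1 else 0) + (if sgn x = s then card ?D else 0)"
      unfolding eq by auto
    show ?thesis
    proof (cases "S = {}")
      case True
      then show ?thesis
        unfolding cardeq ins using \<open>sgn x = s \<or> sgn x = - s\<close>
        by (auto simp: alternating.empty)
    next
      case False
      then have "\<not> (alternating s S \<and> alternating (- s) S)"
        using alternating_sign_unique insert.prems(2) by blast
      then show ?thesis
        unfolding cardeq ins using \<open>sgn x = s \<or> sgn x = - s\<close> IH s False by auto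
    qed
  qed
qed

text \<open>The same parity for a simplex whose vertices carry labels that may coincide. If exactly one value is
  repeated, the two facets that omit one of its two occurrences carry the same labels, so they are
  counted together or not at all; further repetitions survive in every facet.\<close>

lemma odd_alternating_facets:
  fixes g :: "nat \<Rightarrow> int"
  assumes "finite K" "K \<noteq> {}" "\<And>i j. i \<in> K \<Longrightarrow> j \<in> K \<Longrightarrow> g i \<noteq> - g j" "\<bar>s\<bar> = 1"
  shows "odd (card {j \<in> K. inj_on g (K - {j}) \<and> alternating s (g ` (K - {j}))}) \<longleftrightarrow>
         inj_on g K \<and> (alternating s (g ` K) \<or> alternating (- s) (g ` K))"
proof (cases "inj_on g K")
  case True
  let ?J = "{j \<in> K. inj_on g (K - {j}) \<and> alternating s (g ` (K - {j}))}"
  have img: "g ` (K - {j}) = g ` K - {g j}" if "j \<in> K" for j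
    using True that by (auto dest: inj_onD)
  have "g ` ?J = {x \<in> g ` K. alternating s (g ` K - {x})}"
    using img True by (auto simp: inj_on_diff)
  moreover have "card (g ` ?J) = card ?J"
    by (rule card_image, rule inj_on_subset[OF True]) auto
  moreover have "x \<noteq> - y" if "x \<in> g ` K" "y \<in> g ` K" for x y
    using that assms(3) by auto
  ultimately show ?thesis
    using odd_alternating_deletions[of "g ` K" s] assms(1,2,4) True by simp
next
  case False
  then obtain a b where ab: "a \<in> K" "b \<in> K" "a \<noteq> b" "g a = g b"
    unfolding inj_on_def by blast
  let ?J = "{j \<in> K. inj_on g (K - {j}) \<and> alternating s (g ` (K - {j}))}"
  have "?J \<subseteq> {a, b}"
  proof
    fix j assume "j \<in> ?J"
    then have "inj_on g (K - {j})" by blast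
    then show "j \<in> {a, b}" using ab by (metis DiffI inj_onD insertCI singletonD)
  qed
  moreover have "a \<in> ?J \<longleftrightarrow> b \<in> ?J"
  proof -
    have swap: "inj_on g (K - {j})" if "inj_on g (K - {i})" "{i, j} = {a, b}" for i j
    proof (rule inj_onI)
      fix x y assume xy: "x \<in> K - {j}" "y \<in> K - {j}" "g x = g y"
      \<comment> \<open>The labels do not distinguish \<open>i\<close> from \<open>j\<close>, so \<open>j\<close> can stand in for \<open>i\<close>.\<close>
      let ?f = "\<lambda>z. if z = i then j else z"
      have ij: "i \<in> K" "j \<in> K" "i \<noteq> j" "g i = g j" using that ab by (auto simp: doubleton_eq_iff)
      have "g (?f x) = g (?f y)" "?f x \<in> K - {i}" "?f y \<in> K - {i}" using xy ij by auto
      then have "?f x = ?f y" by (rule inj_onD[OF that(1)])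
      then show "x = y" using xy by (auto split: if_splits)
    qed
    have "g ` (K - {a}) = g ` (K - {b})"
      using ab by (auto simp: image_iff) (metis DiffI singletonD)+
    then show ?thesis using swap[of a b] swap[of b a] ab by auto
  qed
  ultimately have "?J = {} \<or> ?J = {a, b}" by blast
  moreover have "even (card {})" "even (card {a, b})" using ab(3) by auto
  ultimately have "even (card ?J)" by (elim disjE) (simp_all only:)
  then show ?thesis using False by blast
qed

section \<open>Maximal chains of sign vectors\<close>

text \<open>A sign vector is encoded as the set of its nonzero coordinates with their signs (\<open>True\<close> for plus).
  The nonzero sign vectors of length \<open>n\<close>, ordered by inclusion, form the barycentric subdivision of the
  boundary of the \<open>n\<close>-dimensional cross-polytope. A maximal chain adds one signed coordinate at a time,
  so it is a list of signed coordinates; its \<open>k\<close>-th member is the set of the first \<open>k\<close> entries,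
  \<open>1 \<le> k \<le> n\<close>.\<close>

definition signed_orders :: "nat \<Rightarrow> (nat \<times> bool) list set" where
  "signed_orders n = {xs. distinct (map fst xs) \<and> fst ` set xs = {..<n}}"

lemma length_signed_orders: "xs \<in> signed_orders n \<Longrightarrow> length xs = n"
  unfolding signed_orders_def
  by (metis (mono_tags, lifting) card_lessThan distinct_card length_map list.set_map mem_Collect_eq)

lemma finite_signed_orders: "finite (signed_orders n)"
proof (rule finite_subset)
  show "signed_orders n \<subseteq> {xs. set xs \<subseteq> {..<n} \<times> UNIV \<and> length xs = n}"
  proof
    fix xs assume xs: "xs \<in> signed_orders n"
    then have "set xs \<subseteq> fst ` set xs \<times> UNIV" by force
    then show "xs \<in> {xs. set xs \<subseteq> {..<n} \<times> UNIV \<and> length xs = n}"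
      using xs length_signed_orders by (auto simp: signed_orders_def)
  qed
  show "finite {xs. set xs \<subseteq> {..<n} \<times> (UNIV :: bool set) \<and> length xs = n}"
    by (intro finite_lists_length_eq) auto
qed

definition sign_vector :: "nat \<Rightarrow> (nat \<times> bool) set \<Rightarrow> bool" where
  "sign_vector n X \<longleftrightarrow> X \<noteq> {} \<and> fst ` X \<subseteq> {..<n} \<and> inj_on fst X"

definition antipode :: "(nat \<times> bool) set \<Rightarrow> (nat \<times> bool) set" where
  "antipode X = map_prod id Not ` X"

lemma sign_vector_take:
  assumes "xs \<in> signed_orders n" "k \<in> {1..n}" "n \<le> N"
  shows "sign_vector N (set (take k xs))"
  unfolding sign_vector_def
proof (intro conjI)
  show "set (take k xs) \<noteq> {}"
    using assms length_signed_orders by fastforce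
  show "fst ` set (take k xs) \<subseteq> {..<N}"
  proof -
    have "fst ` set (take k xs) \<subseteq> fst ` set xs" by (intro image_mono set_take_subset)
    also have "\<dots> \<subseteq> {..<N}" using assms by (auto simp: signed_orders_def)
    finally show ?thesis .
  qed
  show "inj_on fst (set (take k xs))"
    using assms(1) set_take_subset[of k xs] inj_on_subset
    by (auto simp: signed_orders_def distinct_map)
qed

definition reverse_signs :: "(nat \<times> bool) list \<Rightarrow> (nat \<times> bool) list" where
  "reverse_signs = map (map_prod id Not)"

lemma reverse_signs_reverse_signs [simp]: "reverse_signs (reverse_signs xs) = xs"
  by (simp add: reverse_signs_def prod.map_comp map_idI map_prod_def split_beta)

lemma reverse_signs_in_signed_orders:
  "xs \<in> signed_orders n \<Longrightarrow> reverse_signs xs \<in> signed_orders n"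
  by (simp add: signed_orders_def reverse_signs_def comp_def image_image)

lemma mem_reverse_signs [simp]: "(i, b) \<in> set (reverse_signs xs) \<longleftrightarrow> (i, \<not> b) \<in> set xs"
  by (force simp: reverse_signs_def)

lemma True_xor_False_mem_signed_order:
  assumes "xs \<in> signed_orders n" "i < n"
  shows "(i, True) \<in> set xs \<longleftrightarrow> (i, False) \<notin> set xs"
proof -
  have "i \<in> fst ` set xs" "inj_on fst (set xs)"
    using assms by (auto simp: signed_orders_def distinct_map)
  then obtain b where b: "(i, b) \<in> set xs" by auto
  then have "b' = b" if "(i, b') \<in> set xs" for b'
    using inj_onD[OF \<open>inj_on fst (set xs)\<close> _ that b] by simp
  then show ?thesis using b by (cases b) auto
qed

text \<open>Exchanging the entries numbered \<open>j - 1\<close> and \<open>j\<close> (counted from zero) changes the \<open>j\<close>-th member of the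
  chain and no other one.\<close>

definition swap_adjacent :: "nat \<Rightarrow> 'a list \<Rightarrow> 'a list" where
  "swap_adjacent j xs = xs[j - 1 := xs ! j, j := xs ! (j - 1)]"

lemma swap_adjacent_swap_adjacent [simp]:
  "0 < j \<Longrightarrow> j < length xs \<Longrightarrow> swap_adjacent j (swap_adjacent j xs) = xs"
  by (rule nth_equalityI) (auto simp: swap_adjacent_def nth_list_update)

lemma set_take_swap_adjacent:
  assumes "0 < j" "j < length xs" "k \<noteq> j"
  shows "set (take k (swap_adjacent j xs)) = set (take k xs)"
proof (cases "k < j")
  case True
  then show ?thesis by (simp add: swap_adjacent_def)
next
  case False
  then have "take k (swap_adjacent j xs) = (take k xs)[j - 1 := take k xs ! j, j := take k xs ! (j - 1)]"
    using assms by (simp add: swap_adjacent_def take_update_swap)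
  also have "set \<dots> = set (take k xs)"
    using False assms by (intro set_swap) auto
  finally show ?thesis .
qed

lemma set_swap_adjacent:
  "0 < j \<Longrightarrow> j < length xs \<Longrightarrow> set (swap_adjacent j xs) = set xs"
  unfolding swap_adjacent_def by (intro set_swap) auto

lemma swap_adjacent_in_signed_orders:
  assumes "xs \<in> signed_orders n" "0 < j" "j < n"
  shows "swap_adjacent j xs \<in> signed_orders n"
proof -
  have len: "length xs = n" using assms(1) by (rule length_signed_orders)
  have "map fst (swap_adjacent j xs) = swap_adjacent j (map fst xs)"
    using assms len by (simp add: swap_adjacent_def map_update)
  moreover have "distinct (swap_adjacent j (map fst xs)) \<longleftrightarrow> distinct (map fst xs)"
    unfolding swap_adjacent_def using assms len by (intro distinct_swap) auto
  ultimately show ?thesis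
    using assms len set_swap_adjacent[of j xs] by (simp add: signed_orders_def)
qed

text \<open>Only the last member of the chain, the one of full support, is changed.\<close>

definition flip_last :: "(nat \<times> bool) list \<Rightarrow> (nat \<times> bool) list" where
  "flip_last xs = xs[length xs - 1 := map_prod id Not (last xs)]"

lemma flip_last_append: "flip_last (ys @ [(i, b)]) = ys @ [(i, \<not> b)]"
  by (simp add: flip_last_def)

lemma signed_orders_SucE:
  assumes "xs \<in> signed_orders (Suc n)"
  obtains ys i b where "xs = ys @ [(i, b)]" "length ys = n"
proof -
  have "length xs = Suc n" using assms by (rule length_signed_orders)
  then obtain ys y where "xs = ys @ [y]" by (metis length_Suc_conv_rev)
  then show ?thesis using that[of ys "fst y" "snd y"] \<open>length xs = Suc n\<close> by simp
qed

lemma append_in_signed_orders_iff: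
  "ys @ [(n, b)] \<in> signed_orders (Suc n) \<longleftrightarrow> ys \<in> signed_orders n"
proof -
  have "insert n A = {..<Suc n} \<longleftrightarrow> A = {..<n}" if "n \<notin> A" for A :: "nat set"
    using that unfolding lessThan_Suc by (metis insert_ident lessThan_iff less_irrefl)
  then show ?thesis
    by (auto simp: signed_orders_def)
qed

section \<open>Fan's parity theorem and Tucker's lemma\<close>

locale antipodal_labelling =
  fixes N :: nat and l :: "(nat \<times> bool) set \<Rightarrow> int"
  assumes label_antipode: "sign_vector N X \<Longrightarrow> l (antipode X) = - l X"
    and no_complementary_labels: "sign_vector N X \<Longrightarrow> sign_vector N Y \<Longrightarrow> X \<subseteq> Y \<Longrightarrow> l X \<noteq> - l Y"
begin

definition chain_label :: "(nat \<times> bool) list \<Rightarrow> nat \<Rightarrow> int" where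
  "chain_label xs k = l (set (take k xs))"

definition alternating_on :: "int \<Rightarrow> (nat \<times> bool) list \<Rightarrow> nat set \<Rightarrow> bool" where
  "alternating_on s xs K \<longleftrightarrow>
     inj_on (chain_label xs) K \<and> alternating s (chain_label xs ` K)"

definition alternating_chains :: "nat \<Rightarrow> (nat \<times> bool) list set" where
  "alternating_chains n = {xs \<in> signed_orders n. alternating_on 1 xs {1..n}}"

lemma chain_labels_not_complementary:
  assumes "xs \<in> signed_orders n" "n \<le> N" "i \<in> {1..n}" "j \<in> {1..n}"
  shows "chain_label xs i \<noteq> - chain_label xs j"
proof -
  have *: "l (set (take i xs)) \<noteq> - l (set (take j xs))"
    if "i \<le> j" "i \<in> {1..n}" "j \<in> {1..n}" for i j
    using that assms by (intro no_complementary_labels sign_vector_take set_take_subset_set_take)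
  show ?thesis
  proof (cases "i \<le> j")
    case True
    then show ?thesis using * assms by (simp add: chain_label_def)
  next
    case False
    then have "chain_label xs j \<noteq> - chain_label xs i" using *[of j i] assms by (simp add: chain_label_def)
    then show ?thesis by simp
  qed
qed

lemma alternating_on_cong:
  "(\<And>k. k \<in> K \<Longrightarrow> chain_label xs k = chain_label ys k) \<Longrightarrow>
   alternating_on s xs K \<longleftrightarrow> alternating_on s ys K"
  unfolding alternating_on_def by (auto cong: inj_on_cong image_cong)

lemma alternating_on_reverse_signs:
  assumes "xs \<in> signed_orders n" "n \<le> N" "alternating_on s xs {1..n}"
  shows "alternating_on (- s) (reverse_signs xs) {1..n}"
proof -
  have eq: "chain_label (reverse_signs xs) k = - chain_label xs k" if "k \<in> {1..n}" for k
    using label_antipode[OF sign_vector_take[OF assms(1) that assms(2)]]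
    by (simp add: chain_label_def reverse_signs_def antipode_def take_map)
  have "chain_label (reverse_signs xs) ` {1..n} = uminus ` chain_label xs ` {1..n}"
    unfolding image_image using eq by (rule image_cong[OF refl])
  moreover have "inj_on (chain_label (reverse_signs xs)) {1..n}"
  proof (rule inj_onI)
    fix i j assume ij: "i \<in> {1..n}" "j \<in> {1..n}"
      "chain_label (reverse_signs xs) i = chain_label (reverse_signs xs) j"
    then have "chain_label xs i = chain_label xs j" using eq[OF ij(1)] eq[OF ij(2)] by simp
    then show "i = j" using assms(3) ij(1,2) unfolding alternating_on_def by (meson inj_onD)
  qed
  ultimately show ?thesis
    using alternating_uminus assms(3) by (simp add: alternating_on_def)
qed

text \<open>The upper hemisphere contains exactly one chain of each antipodal pair, and the antipodal map turns
  chains that alternate from plus into chains that alternate from minus. So counting both kinds in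
  the hemisphere is the same as counting one kind in the whole sphere.\<close>

lemma card_alternating_chains_hemisphere:
  assumes "Suc n \<le> N"
  shows "card {xs \<in> signed_orders (Suc n). (n, True) \<in> set xs \<and>
           (alternating_on 1 xs {1..Suc n} \<or> alternating_on (- 1) xs {1..Suc n})}
         = card (alternating_chains (Suc n))"
proof -
  let ?C = "signed_orders (Suc n)"
  let ?up = "{xs \<in> ?C. (n, True) \<in> set xs \<and> alternating_on 1 xs {1..Suc n}}"
  let ?low = "{xs \<in> ?C. (n, True) \<notin> set xs \<and> alternating_on 1 xs {1..Suc n}}"
  let ?neg = "{xs \<in> ?C. (n, True) \<in> set xs \<and> alternating_on (- 1) xs {1..Suc n}}"
  note fin = finite_signed_orders[of "Suc n"]
  have "bij_betw reverse_signs ?low ?neg"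
  proof (rule bij_betw_byWitness[where f' = reverse_signs])
    show "reverse_signs ` ?low \<subseteq> ?neg"
      using alternating_on_reverse_signs[where n = "Suc n" and s = 1] assms
        True_xor_False_mem_signed_order[of _ "Suc n" n]
      by (auto simp: reverse_signs_in_signed_orders)
    show "reverse_signs ` ?neg \<subseteq> ?low"
      using alternating_on_reverse_signs[where n = "Suc n" and s = "- 1"] assms
        True_xor_False_mem_signed_order[of _ "Suc n" n]
      by (auto simp: reverse_signs_in_signed_orders)
  qed auto
  then have "card ?low = card ?neg" by (rule bij_betw_same_card)
  moreover have "alternating_chains (Suc n) = ?up \<union> ?low"
    unfolding alternating_chains_def by blast
  then have "card (alternating_chains (Suc n)) = card (?up \<union> ?low)" by (rule arg_cong)
  then have "card (alternating_chains (Suc n)) = card ?up + card ?low"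
    using fin by (subst (asm) card_Un_disjoint) auto
  moreover have "{xs \<in> ?C. (n, True) \<in> set xs \<and>
      (alternating_on 1 xs {1..Suc n} \<or> alternating_on (- 1) xs {1..Suc n})} = ?up \<union> ?neg"
    by blast
  moreover have "\<not> (alternating 1 (chain_label xs ` {1..Suc n}) \<and>
      alternating (- 1) (chain_label xs ` {1..Suc n}))" for xs
    using alternating_sign_unique[of 1 "chain_label xs ` {1..Suc n}"] by auto
  then have "?up \<inter> ?neg = {}"
    unfolding alternating_on_def by blast
  then have "card (?up \<union> ?neg) = card ?up + card ?neg"
    using fin by (intro card_Un_disjoint) auto
  ultimately show ?thesis by (simp only:)
qed

text \<open>A facet of a maximal chain omits one member. Its partner is the same facet seen from the other maximal
  chain of the upper hemisphere that contains it: an inner member can be completed in two orders, and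
  the last member with two signs. When the missing last coordinate is \<open>n - 1\<close>, only the sign plus
  stays in the hemisphere; these facets make up the equator and are their own partners.\<close>

definition facet_partner :: "nat \<Rightarrow> (nat \<times> bool) list \<times> nat \<Rightarrow> (nat \<times> bool) list \<times> nat" where
  "facet_partner n = (\<lambda>(xs, j).
     (if j < n then swap_adjacent j xs
      else if fst (last xs) = n - 1 then xs else flip_last xs, j))"

definition alternating_facets :: "nat \<Rightarrow> ((nat \<times> bool) list \<times> nat) set" where
  "alternating_facets n = {(xs, j). xs \<in> signed_orders n \<and> (n - 1, True) \<in> set xs \<and>
     j \<in> {1..n} \<and> alternating_on 1 xs ({1..n} - {j})}"

lemma facet_partner_closed:
  assumes "p \<in> alternating_facets (Suc n)"
  shows "facet_partner (Suc n) p \<in> alternating_facets (Suc n)"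
    and "facet_partner (Suc n) (facet_partner (Suc n) p) = p"
proof -
  obtain xs j where p: "p = (xs, j)" by (cases p)
  have xs: "xs \<in> signed_orders (Suc n)" "(n, True) \<in> set xs" "j \<in> {1..Suc n}"
    "alternating_on 1 xs ({1..Suc n} - {j})"
    using assms p by (auto simp: alternating_facets_def)
  have len: "length xs = Suc n" using xs(1) by (rule length_signed_orders)
  obtain ys i b where ys: "xs = ys @ [(i, b)]" "length ys = n"
    using xs(1) by (rule signed_orders_SucE)
  let ?G = "facet_partner (Suc n) p \<in> alternating_facets (Suc n) \<and>
    facet_partner (Suc n) (facet_partner (Suc n) p) = p"
  consider "j < Suc n" | "j = Suc n" "i = n" | "j = Suc n" "i \<noteq> n" using xs(3) by fastforce
  then have ?G
  proof cases
    case 1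
    have "alternating_on 1 (swap_adjacent j xs) ({1..Suc n} - {j})"
      using xs(4) by (subst alternating_on_cong[of _ _ xs])
        (use 1 xs(3) len in \<open>auto simp: chain_label_def set_take_swap_adjacent\<close>)
    then show ?thesis
      using 1 xs len p swap_adjacent_in_signed_orders[OF xs(1)] set_swap_adjacent[of j xs]
      by (auto simp: facet_partner_def alternating_facets_def)
  next
    case 2
    then show ?thesis using assms p ys by (simp add: facet_partner_def)
  next
    case 3
    have flip: "flip_last xs = ys @ [(i, \<not> b)]" using ys(1) by (simp add: flip_last_append)
    have "alternating_on 1 (flip_last xs) ({1..Suc n} - {j})"
      using xs(4) by (subst alternating_on_cong[of _ _ xs])
        (use 3 ys flip in \<open>auto simp: chain_label_def\<close>)
    moreover have "flip_last xs \<in> signed_orders (Suc n)" "(n, True) \<in> set (flip_last xs)"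
      using xs(1,2) 3 ys(1) flip by (auto simp: signed_orders_def)
    ultimately show ?thesis
      using 3 xs p ys flip by (simp add: facet_partner_def alternating_facets_def flip_last_append)
  qed
  then show "facet_partner (Suc n) p \<in> alternating_facets (Suc n)"
    and "facet_partner (Suc n) (facet_partner (Suc n) p) = p" by simp_all
qed

text \<open>The equator is the sphere of one dimension less.\<close>

lemma fixed_alternating_facets:
  "{p \<in> alternating_facets (Suc n). facet_partner (Suc n) p = p} =
   (\<lambda>ys. (ys @ [(n, True)], Suc n)) ` alternating_chains n"
proof -
  have restrict: "alternating_on 1 (ys @ [(n, True)]) ({1..Suc n} - {Suc n}) \<longleftrightarrow>
      alternating_on 1 ys {1..n}" if "length ys = n" for ys
  proof -
    have "{1..Suc n} - {Suc n} = {1..n}" by auto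
    then show ?thesis using that by (simp only:) (rule alternating_on_cong, auto simp: chain_label_def)
  qed
  show ?thesis
  proof (intro equalityI subsetI)
    fix p assume "p \<in> {p \<in> alternating_facets (Suc n). facet_partner (Suc n) p = p}"
    moreover obtain xs j where p: "p = (xs, j)" by (cases p)
    ultimately have xs: "xs \<in> signed_orders (Suc n)" "(n, True) \<in> set xs" "j \<in> {1..Suc n}"
      "alternating_on 1 xs ({1..Suc n} - {j})"
      and fixed: "facet_partner (Suc n) (xs, j) = (xs, j)"
      by (auto simp: alternating_facets_def)
    have len: "length xs = Suc n" and dist: "distinct xs"
      using xs(1) length_signed_orders by (auto simp: signed_orders_def distinct_map)
    obtain ys i b where ys: "xs = ys @ [(i, b)]" "length ys = n"
      using xs(1) by (rule signed_orders_SucE)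
    have j: "j = Suc n"
    proof (rule ccontr)
      assume "j \<noteq> Suc n"
      then have j: "0 < j" "j < Suc n" using xs(3) by auto
      then have "swap_adjacent j xs ! j = xs ! j" using fixed by (simp add: facet_partner_def)
      then have "xs ! (j - 1) = xs ! j" using j len by (simp add: swap_adjacent_def)
      then show False using dist j len by (simp add: nth_eq_iff_index_eq)
    qed
    then have i: "i = n" using fixed ys(1) by (auto simp: facet_partner_def flip_last_append split: if_splits)
    then have "(n, b) \<in> set xs" using ys(1) by simp
    then have b: b using xs(1,2) True_xor_False_mem_signed_order[of xs "Suc n" n] by (cases b) auto
    have "ys \<in> alternating_chains n"
      using xs(1,4) ys i b j restrict append_in_signed_orders_iff
      by (simp add: alternating_chains_def)
    then show "p \<in> (\<lambda>ys. (ys @ [(n, True)], Suc n)) ` alternating_chains n"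
      using p ys(1) i b j by simp
  next
    fix p assume "p \<in> (\<lambda>ys. (ys @ [(n, True)], Suc n)) ` alternating_chains n"
    then obtain ys where p: "p = (ys @ [(n, True)], Suc n)" and
      ys: "ys \<in> signed_orders n" "alternating_on 1 ys {1..n}"
      by (auto simp: alternating_chains_def)
    show "p \<in> {p \<in> alternating_facets (Suc n). facet_partner (Suc n) p = p}"
      unfolding p using ys restrict length_signed_orders[OF ys(1)] append_in_signed_orders_iff
      by (simp add: alternating_facets_def facet_partner_def)
  qed
qed

text \<open>The pairs of a chain in the upper hemisphere and an alternating facet of it are counted twice, modulo
  two. Chain by chain, \<open>odd_alternating_facets\<close> leaves only the alternating chains of the hemisphere.
  Facet by facet, \<open>facet_partner\<close> cancels everything except the alternating chains of the equator,
  whose number is odd by induction.\<close>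

theorem odd_card_alternating_chains: "n \<le> N \<Longrightarrow> odd (card (alternating_chains n))"
proof (induction n)
  case 0
  have "alternating_chains 0 = {[]}"
    by (auto simp: alternating_chains_def signed_orders_def alternating_on_def alternating.empty)
  then show ?case by simp
next
  case (Suc n)
  let ?H = "{xs \<in> signed_orders (Suc n). (n, True) \<in> set xs}"
  let ?J = "\<lambda>xs. {j \<in> {1..Suc n}. alternating_on 1 xs ({1..Suc n} - {j})}"
  have fin: "finite ?H" using finite_signed_orders by simp
  have facets: "alternating_facets (Suc n) = Sigma ?H ?J"
    by (auto simp: alternating_facets_def)
  then have finP: "finite (alternating_facets (Suc n))" using fin by simp
  have "odd (card (?J xs)) \<longleftrightarrow>
      alternating_on 1 xs {1..Suc n} \<or> alternating_on (- 1) xs {1..Suc n}" if "xs \<in> ?H" for xs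
  proof -
    have "odd (card (?J xs)) \<longleftrightarrow> inj_on (chain_label xs) {1..Suc n} \<and>
      (alternating 1 (chain_label xs ` {1..Suc n}) \<or> alternating (- 1) (chain_label xs ` {1..Suc n}))"
      unfolding alternating_on_def
      by (rule odd_alternating_facets)
        (use that chain_labels_not_complementary[of xs "Suc n"] Suc.prems in auto)
    then show ?thesis by (auto simp: alternating_on_def)
  qed
  then have "{xs \<in> ?H. odd (card (?J xs))} = {xs \<in> signed_orders (Suc n). (n, True) \<in> set xs \<and>
      (alternating_on 1 xs {1..Suc n} \<or> alternating_on (- 1) xs {1..Suc n})}"
    by blast
  then have "card {xs \<in> ?H. odd (card (?J xs))} = card (alternating_chains (Suc n))"
    using card_alternating_chains_hemisphere Suc.prems by simp
  moreover have "card (alternating_facets (Suc n)) = (\<Sum>xs\<in>?H. card (?J xs))"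
    unfolding facets using fin by (intro card_SigmaI) auto
  then have "odd (card (alternating_facets (Suc n))) \<longleftrightarrow> odd (card {xs \<in> ?H. odd (card (?J xs))})"
    using fin by (simp only: even_sum_iff)
  moreover have "odd (card (alternating_facets (Suc n))) \<longleftrightarrow> odd (card (alternating_chains n))"
  proof -
    have "card ((\<lambda>ys. (ys @ [(n, True)], Suc n)) ` alternating_chains n) = card (alternating_chains n)"
      by (rule card_image) (auto simp: inj_on_def)
    moreover have "odd (card (alternating_facets (Suc n))) \<longleftrightarrow>
        odd (card {p \<in> alternating_facets (Suc n). facet_partner (Suc n) p = p})"
      using finP facet_partner_closed by (rule odd_card_involution)
    ultimately show ?thesis
      unfolding fixed_alternating_facets by simp
  qed
  ultimately show ?case using Suc by simp
qed

text \<open>Along an alternating chain the labels have \<open>N\<close> distinct absolute values.\<close>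

corollary tucker_bound:
  assumes "\<And>X. sign_vector N X \<Longrightarrow> \<bar>l X\<bar> \<le> int m"
  shows "N \<le> m"
proof -
  have "alternating_chains N \<noteq> {}" using odd_card_alternating_chains[of N] by auto
  then obtain xs where xs: "xs \<in> signed_orders N" "inj_on (chain_label xs) {1..N}"
    by (auto simp: alternating_chains_def alternating_on_def)
  have inj: "inj_on (\<lambda>k. \<bar>chain_label xs k\<bar>) {1..N}"
  proof (rule inj_onI)
    fix i j assume ij: "i \<in> {1..N}" "j \<in> {1..N}" "\<bar>chain_label xs i\<bar> = \<bar>chain_label xs j\<bar>"
    then have "chain_label xs i = chain_label xs j"
      using chain_labels_not_complementary[OF xs(1) order_refl ij(1,2)] by linarith
    then show "i = j" using xs(2) ij by (meson inj_onD)
  qed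
  have sub: "(\<lambda>k. \<bar>chain_label xs k\<bar>) ` {1..N} \<subseteq> {1..int m}"
  proof
    fix v assume "v \<in> (\<lambda>k. \<bar>chain_label xs k\<bar>) ` {1..N}"
    then obtain k where k: "k \<in> {1..N}" "v = \<bar>chain_label xs k\<bar>" by blast
    have "chain_label xs k \<noteq> 0"
      using chain_labels_not_complementary[OF xs(1) order_refl k(1) k(1)] by linarith
    moreover have "\<bar>chain_label xs k\<bar> \<le> int m"
      unfolding chain_label_def by (rule assms[OF sign_vector_take[OF xs(1) k(1) order_refl]])
    ultimately show "v \<in> {1..int m}" using k(2) by simp
  qed
  have "card ((\<lambda>k. \<bar>chain_label xs k\<bar>) ` {1..N}) \<le> card {1..int m}"
    using sub by (intro card_mono) auto
  then show ?thesis using card_image[OF inj] by simp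
qed

end

section \<open>The chromatic number of Kneser graphs\<close>

definition side :: "bool \<Rightarrow> (nat \<times> bool) set \<Rightarrow> nat set" where
  "side b X = {i. (i, b) \<in> X}"

lemma side_mono: "X \<subseteq> Y \<Longrightarrow> side b X \<subseteq> side b Y"
  by (auto simp: side_def)

lemma side_antipode: "side b (antipode X) = side (\<not> b) X"
  by (force simp: side_def antipode_def)

lemma finite_sign_vector: "sign_vector n X \<Longrightarrow> finite X"
  unfolding sign_vector_def by (meson finite_imageD finite_lessThan finite_subset)

lemma sides_disjoint: "sign_vector n X \<Longrightarrow> side True X \<inter> side False X = {}"
  by (fastforce simp: sign_vector_def side_def inj_on_def)

lemma side_subset: "sign_vector n X \<Longrightarrow> side b X \<subseteq> {..<n}"
  by (force simp: sign_vector_def side_def)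

lemma card_eq_card_sides:
  assumes "sign_vector n X"
  shows "card X = card (side True X) + card (side False X)"
proof -
  have "fst ` X = side True X \<union> side False X"
  proof (intro equalityI subsetI)
    fix i assume "i \<in> fst ` X"
    then obtain b where "(i, b) \<in> X" by auto
    then show "i \<in> side True X \<union> side False X" by (cases b) (auto simp: side_def)
  qed (force simp: side_def)
  moreover have "finite (side b X)" for b
    using side_subset[OF assms] finite_subset by blast
  ultimately have "card (fst ` X) = card (side True X) + card (side False X)"
    using sides_disjoint[OF assms] by (simp add: card_Un_disjoint)
  then show ?thesis using assms by (simp add: sign_vector_def card_image)
qed

lemma card_antipode: "card (antipode X) = card X"
  unfolding antipode_def by (rule card_image) (auto simp: inj_on_def)

text \<open>Matousek's labelling. A vector with at most \<open>2 * t - 2\<close> nonzero coordinates is labelled by their number,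
  with the sign of the first of them. A larger vector has a side with at least \<open>t\<close> elements, and its
  label is \<open>2 * t - 1\<close> plus the least colour of a \<open>t\<close>-set inside one of its sides, with the sign of that
  side. Since \<open>t\<close>-sets on opposite sides are disjoint and hence coloured differently, the sign is well
  defined and complementary labels on comparable vectors cannot occur. Tucker's lemma then bounds \<open>n\<close>
  by the number of absolute values in use.\<close>

theorem kneser_colouring_bound:
  fixes c :: "nat set \<Rightarrow> nat"
  assumes "1 \<le> t"
    and colours: "\<And>A. A \<in> [{..<n}]\<^bsup>t\<^esup> \<Longrightarrow> c A < m"
    and proper: "\<And>A B. A \<in> [{..<n}]\<^bsup>t\<^esup> \<Longrightarrow> B \<in> [{..<n}]\<^bsup>t\<^esup> \<Longrightarrow> A \<inter> B = {} \<Longrightarrow> c A \<noteq> c B"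
  shows "n \<le> 2 * t - 2 + m"
proof -
  define has where "has b q X \<longleftrightarrow> (\<exists>A\<subseteq>side b X. card A = t \<and> c A = q)" for b q X
  define least where "least X = (LEAST q. has True q X \<or> has False q X)" for X
  define height where "height X = (if card X \<le> 2 * t - 2 then card X else 2 * t - 1 + least X)" for X
  define up where "up X \<longleftrightarrow> (if card X \<le> 2 * t - 2 then (Min (fst ` X), True) \<in> X
    else has True (least X) X)" for X
  define l where "l X = (if up X then int (height X) else - int (height X))" for X
  have nsets: "A \<in> [{..<n}]\<^bsup>t\<^esup>" if "sign_vector n X" "A \<subseteq> side b X" "card A = t" for A b X
    using that side_subset[OF that(1), of b] finite_subset[of A "{..<n}"]
    by (auto simp: nsets_def)
  have has_disj: "\<not> (has True q X \<and> has False q X)" if X: "sign_vector n X" for q X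
  proof
    assume "has True q X \<and> has False q X"
    then obtain A B where A: "A \<subseteq> side True X" "card A = t" "c A = q"
      and B: "B \<subseteq> side False X" "card B = t" "c B = q" unfolding has_def by auto
    have "A \<inter> B = {}" using A(1) B(1) sides_disjoint[OF X] by blast
    then have "c A \<noteq> c B" using proper nsets[OF X] A(1,2) B(1,2) by simp
    then show False using A(3) B(3) by simp
  qed
  have has_least: "has True (least X) X \<or> has False (least X) X"
    if X: "sign_vector n X" and large: "\<not> card X \<le> 2 * t - 2" for X
  proof -
    have "t \<le> card (side True X) \<or> t \<le> card (side False X)"
      using card_eq_card_sides[OF X] large by linarith
    then obtain b where "t \<le> card (side b X)" by blast
    then obtain A where "A \<subseteq> side b X" "card A = t" by (metis obtain_subset_with_card_n)
    then have "has b (c A) X" unfolding has_def by blast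
    then have "has True (c A) X \<or> has False (c A) X" by (cases b) auto
    then show ?thesis unfolding least_def by (rule LeastI)
  qed
  have has_antipode: "has b q (antipode X) \<longleftrightarrow> has (\<not> b) q X" for b q X
    unfolding has_def by (simp add: side_antipode)
  have least_antipode: "least (antipode X) = least X" for X
    unfolding least_def by (simp add: has_antipode disj_commute)
  have height_antipode: "height (antipode X) = height X" for X
    by (simp add: height_def card_antipode least_antipode)
  have height_pos: "0 < height X" if "sign_vector n X" for X
    using that finite_sign_vector[OF that] assms(1)
    by (auto simp: height_def sign_vector_def card_gt_0_iff)
  have up_antipode: "up (antipode X) \<longleftrightarrow> \<not> up X" if X: "sign_vector n X" for X
  proof (cases "card X \<le> 2 * t - 2")
    case True
    have img: "fst ` antipode X = fst ` X" by (force simp: antipode_def)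
    have "Min (fst ` X) \<in> fst ` X"
      using X finite_sign_vector[OF X] by (intro Min_in) (auto simp: sign_vector_def)
    then obtain b where b: "(Min (fst ` X), b) \<in> X" by auto
    let ?i = "Min (fst ` X)"
    have "?i \<in> side b X" "side True X \<inter> side False X = {}"
      using b sides_disjoint[OF X] by (auto simp: side_def)
    then have "?i \<in> side True X \<longleftrightarrow> ?i \<notin> side False X" by (cases b) auto
    moreover have "?i \<in> side True (antipode X) \<longleftrightarrow> ?i \<in> side False X"
      by (simp add: side_antipode)
    ultimately show ?thesis using True by (simp add: up_def card_antipode img side_def)
  next
    case False
    then show ?thesis using has_least[OF X] has_disj[OF X]
      by (auto simp: up_def card_antipode least_antipode has_antipode)
  qed
  interpret antipodal_labelling n l
  proof
    fix X assume "sign_vector n X"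
    then show "l (antipode X) = - l X" by (simp add: l_def up_antipode height_antipode)
  next
    fix X Y assume X: "sign_vector n X" and Y: "sign_vector n Y" and XY: "X \<subseteq> Y"
    show "l X \<noteq> - l Y"
    proof
      assume eq: "l X = - l Y"
      then have val: "height X = height Y" and sign: "up X \<longleftrightarrow> \<not> up Y"
        using height_pos[OF X] height_pos[OF Y] by (auto simp: l_def split: if_splits)
      show False
      proof (cases "card X \<le> 2 * t - 2")
        case True
        then have "height Y \<le> 2 * t - 2" using val by (simp add: height_def)
        then have "card Y \<le> 2 * t - 2"
          using assms(1) unfolding height_def by (cases "card Y \<le> 2 * t - 2") auto
        then have "X = Y"
          using val True XY finite_sign_vector[OF Y] by (simp add: height_def card_subset_eq)
        then show False using sign by simp
      next
        case False
        moreover then have largeY: "\<not> card Y \<le> 2 * t - 2"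
          using card_mono[OF finite_sign_vector[OF Y] XY] by linarith
        ultimately have least: "least X = least Y" using val by (simp add: height_def)
        have mono: "has b q Y" if "has b q X" for b q
          using that side_mono[OF XY, of b] unfolding has_def by blast
        show False
          using sign has_least[OF X False] has_disj[OF Y] mono False largeY least
          by (auto simp: up_def)
      qed
    qed
  qed
  have "\<bar>l X\<bar> \<le> int (2 * t - 2 + m)" if X: "sign_vector n X" for X
  proof (cases "card X \<le> 2 * t - 2")
    case True
    then show ?thesis by (simp add: l_def height_def)
  next
    case False
    obtain b A where "A \<subseteq> side b X" "card A = t" "c A = least X"
      using has_least[OF X False] unfolding has_def by blast
    then have "least X < m" using colours[of A] nsets[OF X] by auto
    then show ?thesis using False assms(1) by (simp add: l_def height_def)
  qed
  then show ?thesis by (rule tucker_bound)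
qed

section \<open>Clique number, chromatic number and matching Kneser graphs\<close>

lemma clique_card_le_colours:
  assumes "simple_graph G" "proper_colouring G n c" "K \<subseteq> verts G" "clique K (edges G)"
  shows "card K \<le> n"
proof -
  have "inj_on c K"
  proof (rule inj_onI, rule ccontr)
    fix u v assume uv: "u \<in> K" "v \<in> K" "c u = c v" "u \<noteq> v"
    then have "{u, v} \<in> edges G" using assms(4) by (simp add: clique_def)
    then show False using assms(2,3) uv unfolding proper_colouring_def by blast
  qed
  moreover have "c ` K \<subseteq> {..<n}" using assms(2,3) by (auto simp: proper_colouring_def)
  ultimately show ?thesis using card_inj_on_le[of c K "{..<n}"] by simp
qed

lemma clique_number_eq_chromatic_number:
  assumes "simple_graph G" "proper_colouring G n c"
    and K: "K \<subseteq> verts G" "clique K (edges G)" "card K = n"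
  shows "clique_number G = n" "chromatic_number G = n"
proof -
  show "clique_number G = n"
    unfolding clique_number_def
  proof (rule Max_eqI)
    show "n \<in> {card K | K. K \<subseteq> verts G \<and> clique K (edges G)}" using K by blast
    show "y \<le> n" if "y \<in> {card K | K. K \<subseteq> verts G \<and> clique K (edges G)}" for y
      using that clique_card_le_colours[OF assms(1,2)] by blast
  qed (rule clique_number_set[OF assms(1)])
  obtain c' where "proper_colouring G (chromatic_number G) c'"
    using chromatic_number_colouring[OF assms(1)] by blast
  then have "n \<le> chromatic_number G" using clique_card_le_colours[OF assms(1)] K by blast
  then show "chromatic_number G = n" using chromatic_number_le[OF assms(2)] by simp
qed

lemma verts_matching_kneser: "verts (matching_kneser G r) = matchings G r"
  by (simp add: matching_kneser_def)

lemma matching_kneser_edge_iff: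
  "{M, M'} \<in> edges (matching_kneser G r) \<longleftrightarrow>
     M \<in> matchings G r \<and> M' \<in> matchings G r \<and> M \<noteq> M' \<and> M \<inter> M' = {}"
  by (auto simp: matching_kneser_def doubleton_eq_iff disjnt_def)

section \<open>The graph\<close>

text \<open>The hubs are the vertices below \<open>N\<close>, the independent set is \<open>{N..<N + w}\<close>, and the end vertices of
  the links follow. The first \<open>e\<close> vertices of the independent set carry the links; the bound on \<open>w\<close>
  leaves \<open>2 ^ e\<close> disjoint blocks of \<open>N\<close> further vertices.\<close>

locale hub_graph =
  fixes k N e w :: nat
  assumes k: "2 \<le> k" and hubs: "k - 1 \<le> N" and links: "1 \<le> e" and width: "e + 2 ^ e * N \<le> w"
begin

definition link :: "nat \<Rightarrow> nat set" where
  "link i = {N + i, N + w + i}"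

definition G :: "nat ugraph" where
  "G = \<lparr>verts = {..<N + w + e},
        edges = {{u, v} | u v. u < v \<and> v < k - 1} \<union> {{u, x} | u x. u < N \<and> x \<in> {N..<N + w}}
          \<union> link ` {..<e}\<rparr>"

text \<open>The matching of the hubs into the \<open>a\<close>-th block. It avoids the first \<open>e\<close> vertices of the independent
  set, so it can be combined with any set of links.\<close>

definition spokes :: "nat \<Rightarrow> nat set set" where
  "spokes a = (\<lambda>u. {u, N + e + a * N + u}) ` {..<N}"

definition linked :: "nat set set \<Rightarrow> nat set" where
  "linked M = {i \<in> {..<e}. link i \<in> M}"

lemma N_pos: "0 < N" using k hubs by simp

lemma e_le_w: "e \<le> w" using width by simp

lemma link_eq_iff [simp]: "link i = link j \<longleftrightarrow> i = j"
  unfolding link_def doubleton_eq_iff by linarith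

lemma inj_link: "inj_on link A"
  by (simp add: inj_on_def)

lemma link_in_edges: "i < e \<Longrightarrow> link i \<in> edges G"
  by (simp add: G_def)

lemma hub_edge: "u < N \<Longrightarrow> N \<le> x \<Longrightarrow> x < N + w \<Longrightarrow> {u, x} \<in> edges G"
  by (fastforce simp: G_def)

lemma w_pos: "0 < w" using links e_le_w by simp

lemma edge_cases:
  assumes "x \<in> edges G"
  obtains (core) u v where "x = {u, v}" "u < v" "v < k - 1"
    | (spoke) u v where "x = {u, v}" "u < N" "N \<le> v" "v < N + w"
    | (link) i where "x = link i" "i < e"
  using assms unfolding G_def by auto

lemma simple_graph_G: "simple_graph G"
  unfolding simple_graph_def
proof (intro conjI subsetI)
  show "finite (verts G)" by (simp add: G_def)
  fix x assume "x \<in> edges G"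
  then show "x \<in> [verts G]\<^bsup>2\<^esup>"
  proof (cases rule: edge_cases)
    case (core u v)
    then show ?thesis using hubs by (simp add: G_def)
  next
    case (spoke u v)
    then show ?thesis by (simp add: G_def)
  next
    case (link i)
    then show ?thesis using e_le_w w_pos by (simp add: G_def link_def)
  qed
qed

lemma finite_edges_G: "finite (edges G)"
  using finite_edges simple_graph_G .

lemma connected_G: "connected_graph G"
proof -
  let ?R = "{(x, y). {x, y} \<in> edges G}"
  have step: "(x, y) \<in> ?R\<^sup>*" "(y, x) \<in> ?R\<^sup>*" if "{x, y} \<in> edges G" for x y
    using that by (auto simp: insert_commute intro!: r_into_rtrancl)
  have spoke: "(0, x) \<in> ?R\<^sup>*" "(x, 0) \<in> ?R\<^sup>*" if "N \<le> x" "x < N + w" for x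
    using step[OF hub_edge[OF N_pos that]] by blast+
  have "(0, v) \<in> ?R\<^sup>* \<and> (v, 0) \<in> ?R\<^sup>*" if v: "v < N + w + e" for v
  proof -
    consider "v < N" | "N \<le> v" "v < N + w" | i where "v = N + w + i" "i < e"
      using v by (metis add_less_cancel_left le_Suc_ex not_le)
    then show ?thesis
    proof cases
      case 1
      have "N < N + w" using links e_le_w by simp
      then show ?thesis
        using step[OF hub_edge[OF 1, of N]] spoke[of N] by (meson order_refl rtrancl_trans)
    next
      case 2
      then show ?thesis using spoke by blast
    next
      case 3
      then have "{N + i, v} \<in> edges G" using link_in_edges[of i] by (simp add: link_def)
      moreover have "N + i < N + w" using 3(2) e_le_w by simp
      ultimately show ?thesis
        using step[of "N + i" v] spoke[of "N + i"] by (meson le_add1 rtrancl_trans)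
    qed
  qed
  then show ?thesis
    using N_pos unfolding connected_graph_def by (auto simp: G_def intro: rtrancl_trans)
qed

lemma clique_and_chromatic_number_G: "clique_number G = k" "chromatic_number G = k"
proof -
  \<comment> \<open>Colour 0 serves for the end vertices of the links, whose only neighbours have colour \<open>k - 1 > 0\<close>.\<close>
  let ?c = "\<lambda>v. if v < k - 1 then v else if N \<le> v \<and> v < N + w then k - 1 else 0"
  let ?K = "insert N {..<k - 1}"
  have ne: "?c u \<noteq> ?c v" if edge: "{u, v} \<in> edges G" for u v
  proof -
    consider "u < v" "v < k - 1" | "v < u" "u < k - 1"
      | "u < N" "v \<in> {N..<N + w}" | "v < N" "u \<in> {N..<N + w}"
      | i where "i < e" "u = N + i" "v = N + w + i" | i where "i < e" "v = N + i" "u = N + w + i"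
      using edge by (cases rule: edge_cases) (auto simp: doubleton_eq_iff link_def)
    then show ?thesis using k hubs e_le_w by cases auto
  qed
  have col: "proper_colouring G k ?c"
    unfolding proper_colouring_def
  proof (intro conjI ballI impI)
    show "?c ` verts G \<subseteq> {..<k}" using k by auto
  qed (rule ne)
  have core': "{u, v} \<in> edges G" if "u < v" "v < k - 1" for u v
    using that by (auto simp: G_def)
  have core: "{u, v} \<in> edges G" if "u < k - 1" "v < k - 1" "u \<noteq> v" for u v
  proof (cases "u < v")
    case True
    then show ?thesis using that core' by blast
  next
    case False
    then have "{v, u} \<in> edges G" using that core' by simp
    then show ?thesis by (simp add: insert_commute)
  qed
  have hubN: "{u, N} \<in> edges G" if "u < k - 1" for u
    using hub_edge[of u N] that hubs w_pos by simp
  have hubN': "{N, u} \<in> edges G" if "u < k - 1" for u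
    using hubN[OF that] by (subst insert_commute)
  have "clique ?K (edges G)"
    unfolding clique_def using core hubN hubN' by auto
  moreover have "?K \<subseteq> verts G" using hubs w_pos by (auto simp: G_def)
  moreover have "card ?K = k" using k hubs by simp
  ultimately show "clique_number G = k" "chromatic_number G = k"
    using clique_number_eq_chromatic_number[OF simple_graph_G col] by blast+
qed

lemma edge_meets_hubs:
  assumes "x \<in> edges G" "x \<notin> link ` {..<e}"
  shows "\<exists>u<N. u \<in> x"
  using assms(1)
proof (cases rule: edge_cases)
  case (core u v)
  then show ?thesis using hubs by (intro exI[of _ u]) simp
next
  case (spoke u v)
  then show ?thesis by blast
next
  case (link i)
  then show ?thesis using assms(2) by blast
qed

text \<open>The edges of a matching that are not links use up distinct hubs.\<close>

lemma card_linked_ge: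
  assumes "M \<in> matchings G (N + t)"
  shows "t \<le> card (linked M)"
proof -
  have M: "M \<subseteq> edges G" "finite M" "card M = N + t" "disjoint M"
    using assms by (auto simp: matchings_def nsets_def)
  let ?rest = "M - link ` {..<e}"
  have "\<forall>x\<in>?rest. \<exists>u<N. u \<in> x" using M(1) edge_meets_hubs by blast
  then obtain h where h: "\<And>x. x \<in> ?rest \<Longrightarrow> h x < N \<and> h x \<in> x" by metis
  have "inj_on h ?rest"
  proof (rule inj_onI, rule ccontr)
    fix x y assume xy: "x \<in> ?rest" "y \<in> ?rest" "h x = h y" "x \<noteq> y"
    then have "x \<inter> y = {}" using M(4) by (simp add: disjointD)
    then show False using h[OF xy(1)] h[OF xy(2)] xy(3) by auto
  qed
  then have "card ?rest \<le> card {..<N}" using h by (intro card_inj_on_le) auto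
  moreover have "M \<inter> link ` {..<e} = link ` linked M" by (auto simp: linked_def)
  then have "card (M \<inter> link ` {..<e}) = card (linked M)" by (simp add: card_image inj_link)
  moreover have "card M = card (M \<inter> link ` {..<e}) + card ?rest"
    using M(2) by (metis card_Int_Diff)
  ultimately show ?thesis using M(3) by simp
qed

lemma spokes_bound:
  assumes "a < 2 ^ e" "u < N"
  shows "N + e + a * N + u < N + w"
proof -
  have "a * N + N = (a + 1) * N" by simp
  also have "\<dots> \<le> 2 ^ e * N" using assms(1) by (intro mult_le_mono1) simp
  finally show ?thesis using width assms(2) by linarith
qed

lemma spokes_links_matching:
  assumes "a < 2 ^ e" "A \<subseteq> {..<e}"
  shows "spokes a \<union> link ` A \<in> matchings G (N + card A)"
proof -
  let ?M = "spokes a \<union> link ` A"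
  have finA: "finite A" using assms(2) finite_subset by blast
  have bound: "u < N \<Longrightarrow> N + e + a * N + u < N + w" for u
    using spokes_bound[OF assms(1)] .
  have inj: "inj_on (\<lambda>u. {u, N + e + a * N + u}) {..<N}"
    by (auto simp: inj_on_def doubleton_eq_iff)
  have cross: "{u, N + e + a * N + u} \<inter> link i = {}" if "u < N" "i \<in> A" for u i
    using that bound[OF that(1)] assms(2) by (auto simp: link_def)
  then have "spokes a \<inter> link ` A = {}"
    unfolding spokes_def by blast
  then have "card ?M = N + card A"
    using finA inj by (simp add: card_Un_disjoint spokes_def card_image inj_link)
  moreover have "?M \<subseteq> edges G"
  proof -
    have "spokes a \<subseteq> edges G"
      unfolding spokes_def using bound by (auto intro: hub_edge)
    then show ?thesis using assms(2) link_in_edges by auto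
  qed
  moreover have "disjoint ?M"
  proof (rule disjointI)
    fix x y assume xy: "x \<in> ?M" "y \<in> ?M" "x \<noteq> y"
    then consider u v where "x = {u, N + e + a * N + u}" "y = {v, N + e + a * N + v}" "u < N" "v < N"
      | u i where "x = {u, N + e + a * N + u}" "y = link i" "u < N" "i \<in> A"
      | u i where "y = {u, N + e + a * N + u}" "x = link i" "u < N" "i \<in> A"
      | i j where "x = link i" "y = link j" "i \<in> A" "j \<in> A"
      unfolding spokes_def by blast
    then show "x \<inter> y = {}"
    proof cases
      case 1
      then show ?thesis using xy(3) by auto
    next
      case 2
      then show ?thesis using cross by simp
    next
      case 3
      then show ?thesis using cross[of u i] by (simp add: Int_commute)
    next
      case 4
      then show ?thesis using xy(3) assms(2) e_le_w by (auto simp: link_def)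
    qed
  qed
  ultimately show ?thesis using finA by (simp add: matchings_def nsets_def spokes_def)
qed

lemma spokes_disjoint: "a \<noteq> b \<Longrightarrow> spokes a \<inter> spokes b = {}"
  by (auto simp: spokes_def doubleton_eq_iff)

lemma spokes_link_disjoint: "link i \<notin> spokes a"
  by (auto simp: spokes_def link_def doubleton_eq_iff)

section \<open>The chromatic number of the matching Kneser graph\<close>

text \<open>A matching is coloured by its first link, except that all matchings whose links lie among the last
  \<open>2 * t - 1\<close> ones share one colour: each of them contains at least \<open>t\<close> of these links, so any two of
  them have a link in common.\<close>

lemma chromatic_number_matching_kneser_le:
  assumes "1 \<le> t" "2 * t \<le> e + 1"
  shows "chromatic_number (matching_kneser G (N + t)) \<le> e + 2 - 2 * t"
proof -
  define q where "q = e + 1 - 2 * t"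
  let ?c = "\<lambda>M. min (Min (linked M)) q"
  have "proper_colouring (matching_kneser G (N + t)) (e + 2 - 2 * t) ?c"
    unfolding proper_colouring_def
  proof (intro conjI ballI impI)
    show "?c ` verts (matching_kneser G (N + t)) \<subseteq> {..<e + 2 - 2 * t}"
      using assms by (auto simp: q_def)
  next
    fix M M' assume "{M, M'} \<in> edges (matching_kneser G (N + t))"
    then have M: "M \<in> matchings G (N + t)" "M' \<in> matchings G (N + t)" "M \<inter> M' = {}"
      by (simp_all add: matching_kneser_edge_iff)
    have fin: "finite (linked X)" for X by (simp add: linked_def)
    have card: "t \<le> card (linked M)" "t \<le> card (linked M')" using M card_linked_ge by blast+
    then have ne: "linked M \<noteq> {}" "linked M' \<noteq> {}" using assms(1) by auto
    have disj: "linked M \<inter> linked M' = {}" using M(3) by (auto simp: linked_def)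
    show "?c M \<noteq> ?c M'"
    proof
      assume eq: "?c M = ?c M'"
      show False
      proof (cases "Min (linked M) < q")
        case True
        then have "Min (linked M) = Min (linked M')" using eq by linarith
        then show False using Min_in[OF fin ne(1)] Min_in[OF fin ne(2)] disj by auto
      next
        case False
        then have "q \<le> Min (linked M)" "q \<le> Min (linked M')" using eq by linarith+
        then have "q \<le> x" if "x \<in> linked M \<union> linked M'" for x
          using that Min_le[OF fin[of M], of x] Min_le[OF fin[of M'], of x] by auto
        then have "linked M \<union> linked M' \<subseteq> {q..<e}"
          by (fastforce simp: linked_def)
        then have "card (linked M \<union> linked M') \<le> card {q..<e}"
          by (intro card_mono) auto
        then have "card (linked M \<union> linked M') \<le> e - q" by simp
        moreover have "card (linked M \<union> linked M') = card (linked M) + card (linked M')"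
          using fin disj by (simp add: card_Un_disjoint)
        ultimately show False using card assms by (simp add: q_def)
      qed
    qed
  qed
  then show ?thesis by (rule chromatic_number_le)
qed

text \<open>An injective numbering of the subsets of \<open>{..<e}\<close> selects the block of spokes, so that disjoint
  sets of links are extended to disjoint matchings.\<close>

lemma chromatic_number_matching_kneser_ge:
  assumes "1 \<le> t"
  shows "e \<le> 2 * t - 2 + chromatic_number (matching_kneser G (N + t))"
proof -
  let ?K = "matching_kneser G (N + t)"
  obtain c where c: "proper_colouring ?K (chromatic_number ?K) c"
    using chromatic_number_colouring[OF simple_graph_matching_kneser[OF simple_graph_G]] by blast
  then have bound: "\<And>M. M \<in> matchings G (N + t) \<Longrightarrow> c M < chromatic_number ?K"
    and differ: "\<And>M M'. M \<in> matchings G (N + t) \<Longrightarrow> M' \<in> matchings G (N + t) \<Longrightarrow>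
      {M, M'} \<in> edges ?K \<Longrightarrow> c M \<noteq> c M'"
    by (auto simp: proper_colouring_def verts_matching_kneser)
  obtain code where code: "bij_betw code (Pow {..<e}) {0..<card (Pow {..<e})}"
    using ex_bij_betw_finite_nat[of "Pow {..<e}"] by auto
  let ?M = "\<lambda>A. spokes (code A) \<union> link ` A"
  have M: "?M A \<in> matchings G (N + t)" if "A \<in> [{..<e}]\<^bsup>t\<^esup>" for A
  proof -
    have A: "A \<subseteq> {..<e}" "card A = t" using that by (auto simp: nsets_def)
    then have "code A < 2 ^ e" using bij_betwE[OF code] by (auto simp: card_Pow)
    then show ?thesis using spokes_links_matching[OF _ A(1)] A(2) by simp
  qed
  show ?thesis
  proof (rule kneser_colouring_bound[OF assms, where c = "\<lambda>A. c (?M A)"])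
    show "c (?M A) < chromatic_number ?K" if "A \<in> [{..<e}]\<^bsup>t\<^esup>" for A
      using that by (intro bound M)
    show "c (?M A) \<noteq> c (?M B)"
      if AB: "A \<in> [{..<e}]\<^bsup>t\<^esup>" "B \<in> [{..<e}]\<^bsup>t\<^esup>" "A \<inter> B = {}" for A B
    proof -
      have AB': "A \<in> Pow {..<e}" "B \<in> Pow {..<e}" "A \<noteq> {}" "A \<noteq> B"
        using AB assms by (auto simp: nsets_def)
      then have "code A \<noteq> code B" using code by (meson bij_betw_def inj_onD)
      then have disj: "?M A \<inter> ?M B = {}"
        using AB(3) spokes_disjoint spokes_link_disjoint by auto
      moreover have "?M A \<noteq> {}" using AB'(3) by simp
      ultimately have "?M A \<noteq> ?M B" by (metis inf.idem)
      then have "{?M A, ?M B} \<in> edges ?K"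
        unfolding matching_kneser_edge_iff using M[OF AB(1)] M[OF AB(2)] disj by simp
      with M[OF AB(1)] M[OF AB(2)] show ?thesis by (rule differ)
    qed
  qed
qed

lemma chromatic_number_matching_kneser:
  assumes "1 \<le> t" "2 * t \<le> e + 1"
  shows "chromatic_number (matching_kneser G (N + t)) = e + 2 - 2 * t"
  using chromatic_number_matching_kneser_le[OF assms] chromatic_number_matching_kneser_ge[OF assms(1)] assms
  by linarith

section \<open>The generalized Turan number\<close>

text \<open>If at most \<open>e - t\<close> edges are deleted then \<open>t\<close> links survive. Since \<open>e - t < 2 ^ e\<close>, one of the disjoint
  sets of spokes survives completely, and together they form a matching.\<close>

lemma card_deleted_edges:
  assumes "spanning_subgraph H G" "matching_free H (N + t)" "t \<le> e"
  shows "e - t < card (edges G - edges H)"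
proof (rule ccontr)
  let ?D = "edges G - edges H"
  assume "\<not> e - t < card ?D"
  then have small: "card ?D \<le> e - t" by simp
  have finD: "finite ?D" using finite_edges_G by simp
  have "link ` ({..<e} - linked (edges H)) \<subseteq> ?D"
    using link_in_edges by (auto simp: linked_def)
  then have "card ({..<e} - linked (edges H)) \<le> card ?D"
    using finD card_mono card_image[OF inj_link] by metis
  moreover have "card ({..<e} - linked (edges H)) = e - card (linked (edges H))"
    by (subst card_Diff_subset) (auto simp: linked_def)
  ultimately have "t \<le> card (linked (edges H))" using small assms(3) by linarith
  then obtain A where A: "A \<subseteq> linked (edges H)" "card A = t"
    by (metis obtain_subset_with_card_n)
  have "\<exists>a<2 ^ e. spokes a \<inter> ?D = {}"
  proof (rule ccontr)
    assume "\<not> (\<exists>a<2 ^ e. spokes a \<inter> ?D = {})"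
    then have "\<forall>a\<in>{..<2 ^ e}. \<exists>x. x \<in> spokes a \<inter> ?D" by blast
    then obtain d where d: "\<And>a. a < 2 ^ e \<Longrightarrow> d a \<in> spokes a \<inter> ?D"
      by (metis lessThan_iff)
    have "inj_on d {..<2 ^ e}"
    proof (rule inj_onI, rule ccontr)
      fix a b :: nat assume ab: "a \<in> {..<2 ^ e}" "b \<in> {..<2 ^ e}" "d a = d b" "a \<noteq> b"
      then show False using d[of a] d[of b] spokes_disjoint[OF ab(4)] by auto
    qed
    then have "card {..<2 ^ e :: nat} \<le> card ?D"
      using d finD by (intro card_inj_on_le) auto
    then have "2 ^ e \<le> e" using small by simp
    then show False using less_exp[of e] by linarith
  qed
  then obtain a where a: "a < 2 ^ e" "spokes a \<inter> ?D = {}" by blast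
  let ?M = "spokes a \<union> link ` A"
  have "A \<subseteq> {..<e}" using A(1) by (auto simp: linked_def)
  then have M: "?M \<in> matchings G (N + t)"
    using spokes_links_matching[OF a(1)] A(2) by blast
  then have "?M \<subseteq> edges G" by (simp add: matchings_def nsets_def)
  then have "?M \<subseteq> edges H" using a(2) A(1) by (auto simp: linked_def)
  then have "?M \<in> matchings H (N + t)" using M by (simp add: matchings_def nsets_def)
  then show False using assms(2) by (simp add: matching_free_def)
qed

text \<open>Deleting \<open>e - t + 1\<close> links leaves fewer than the \<open>t\<close> that every matching of this size contains.\<close>

lemma ex_matching_G:
  assumes "1 \<le> t" "t \<le> e"
  shows "int (card (edges G)) - int (ex_matching G (N + t)) = int (e - t + 1)"
proof -
  let ?S = "{card (edges H) | H. spanning_subgraph H G \<and> matching_free H (N + t)}"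
  let ?F = "link ` {..<e - t + 1}"
  let ?H = "\<lparr>verts = verts G, edges = edges G - ?F\<rparr>"
  have sub: "?F \<subseteq> edges G" using assms link_in_edges by auto
  have cardF: "card ?F = e - t + 1" by (simp add: card_image inj_link)
  have le: "e - t + 1 \<le> card (edges G)"
    using card_mono[OF finite_edges_G sub] cardF by simp
  have "ex_matching G (N + t) = card (edges G) - (e - t + 1)"
    unfolding ex_matching_def
  proof (rule Max_eqI)
    show "finite ?S" by (rule ex_matching_set(1)[OF simple_graph_G])
  next
    fix y assume "y \<in> ?S"
    then obtain H where H: "y = card (edges H)" "spanning_subgraph H G" "matching_free H (N + t)"
      by blast
    have "edges H \<subseteq> edges G" using H(2) by (simp add: spanning_subgraph_def)
    then have "card (edges G - edges H) = card (edges G) - card (edges H)"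
      using finite_edges_G finite_subset by (intro card_Diff_subset) auto
    then show "y \<le> card (edges G) - (e - t + 1)"
      using card_deleted_edges[OF H(2,3) assms(2)] H(1) by linarith
  next
    have "matching_free ?H (N + t)"
      unfolding matching_free_def
    proof (rule equals0I)
      fix M assume "M \<in> matchings ?H (N + t)"
      then have M: "M \<in> matchings G (N + t)" "M \<inter> ?F = {}"
        by (auto simp: matchings_def nsets_def)
      then have "linked M \<subseteq> {e - t + 1..<e}" by (fastforce simp: linked_def)
      then have "card (linked M) \<le> e - (e - t + 1)"
        using card_mono[of "{e - t + 1..<e}" "linked M"] by simp
      then show False using card_linked_ge[OF M(1)] assms by simp
    qed
    moreover have "spanning_subgraph ?H G" by (auto simp: spanning_subgraph_def)
    moreover have "card (edges ?H) = card (edges G) - (e - t + 1)"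
      using sub cardF finite_edges_G by (simp add: card_Diff_subset)
    ultimately show "card (edges G) - (e - t + 1) \<in> ?S" by (metis (mono_tags, lifting) mem_Collect_eq)
  qed
  then show ?thesis using le by simp
qed

end

section \<open>The realization theorem\<close>

theorem theorem4:
  fixes r k \<Theta> \<Gamma> :: nat
  assumes "r \<ge> 1" and "k \<ge> 1" and "\<Theta> \<ge> 1" and "\<Gamma> \<ge> 1"
    and "k \<ge> 2"
    and "r \<ge> k + \<Gamma>"
  shows "\<exists>G :: nat ugraph. simple_graph G \<and> connected_graph G \<and>
           clique_number G = k \<and> chromatic_number G = k \<and>
           chromatic_number (matching_kneser G r) = \<Theta> \<and>
           int (card (edges G)) - int (ex_matching G r) = int \<Theta> + int \<Gamma>"
proof -
  define t where "t = \<Gamma> + 1"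
  define N where "N = r - t"
  define e where "e = \<Theta> + 2 * \<Gamma>"
  have r: "r = N + t" using assms by (simp add: N_def t_def)
  interpret hub_graph k N e "e + 2 ^ e * N"
    by unfold_locales (use assms in \<open>auto simp: N_def t_def e_def\<close>)
  have "chromatic_number (matching_kneser G r) = \<Theta>"
    unfolding r using chromatic_number_matching_kneser[of t] assms by (simp add: t_def e_def)
  moreover have "int (card (edges G)) - int (ex_matching G r) = int \<Theta> + int \<Gamma>"
    unfolding r using ex_matching_G[of t] assms by (simp add: t_def e_def)
  ultimately show ?thesis
    using simple_graph_G connected_G clique_and_chromatic_number_G by blast
qed

end
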